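(* Let $H_n$ be the total number of nonempty chains in all plane trees with $n$ edges. Then $\sum_{n\ge0}H_nx^n=\frac{2B}{3-B}$, where $B=\frac{1}{\sqrt{1-4x}}$.
   Context: A plane tree is a rooted tree with linearly ordered children. A chain in a plane tree is a nonempty set of vertices all lying on a single path from the root to a leaf. $H_n$ is the number of pairs $(T,Q)$ with $T$ a plane tree with $n$ edges and $Q$ a chain of $T$. *)

theory Defs
  imports Complex_Main "HOL-Library.Sublist" "HOL-Computational_Algebra.Formal_Power_Series"
begin

datatype plane_tree = Node "plane_tree list"

primrec num_edges :: "plane_tree \<Rightarrow> nat" where
  "num_edges (Node ts) = length ts + sum_list (map num_edges ts)"

text \<open>
  A vertex is represented by its address: the list of (0-based) child positions
  followed when descending from the root, which has address \<open>[]\<close>. The ancestors of a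
  vertex (itself included) are then exactly the prefixes of its address.
\<close>

function vertices :: "plane_tree \<Rightarrow> nat list set" where
  "vertices (Node ts) = insert [] (\<Union>i\<in>{..<length ts}. (#) i ` vertices (ts ! i))"
  by pat_completeness auto
termination
  by (relation "measure size") (auto simp: less_Suc_eq_le intro!: size_list_estimation' [OF nth_mem])

definition leaves :: "plane_tree \<Rightarrow> nat list set" where
  "leaves t = {p \<in> vertices t. \<forall>i. p @ [i] \<notin> vertices t}"

definition root_path :: "nat list \<Rightarrow> nat list set" where
  "root_path p = {q. prefix q p}"

definition chain_of :: "plane_tree \<Rightarrow> nat list set \<Rightarrow> bool" where
  "chain_of t Q \<longleftrightarrow> Q \<noteq> {} \<and> (\<exists>l\<in>leaves t. Q \<subseteq> root_path l)"

definition H :: "nat \<Rightarrow> nat" where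
  "H n = card {(t, Q). num_edges t = n \<and> chain_of t Q}"

end

theory Submission
  imports Defs
begin

unbundle fps_syntax

text \<open>
  Removing the leftmost principal subtree \<open>t\<close> from a tree with at least one edge leaves a smaller
  tree \<open>u\<close>, and \<open>(t, u)\<close> determines the original tree. A chain of the original tree is either a
  chain of \<open>u\<close>, or a chain of \<open>t\<close> with or without the root added. Hence the generating
  functions \<open>C\<close> of trees and \<open>F\<close> of chains satisfy \<open>C = 1 + x C\<^sup>2\<close> and
  \<open>F = 1 + 3 x C F\<close>. The first equation says that \<open>S = 1 - 2 x C\<close> is the square root of
  \<open>1 - 4 x\<close>, and the second one becomes \<open>F (3 S - 1) = 2\<close>.
\<close>

definition chains_of :: "plane_tree \<Rightarrow> nat list set set" where
  "chains_of t = {Q. chain_of t Q}"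

definition trees_of_size :: "nat \<Rightarrow> plane_tree set" where
  "trees_of_size n = {t. num_edges t = n}"

text \<open>Inverts the removal of the leftmost principal subtree; the second argument is what
  remains at the root.\<close>

fun graft_left :: "plane_tree \<Rightarrow> plane_tree \<Rightarrow> plane_tree" where
  "graft_left t (Node ts) = Node (t # ts)"


subsection \<open>Chains of a single tree\<close>

lemma Nil_in_vertices: "[] \<in> vertices t"
  by (cases t) simp

lemma Cons_in_vertices_Node:
  "i # p \<in> vertices (Node ts) \<longleftrightarrow> i < length ts \<and> p \<in> vertices (ts ! i)"
  by auto

lemma finite_vertices: "finite (vertices t)"
  by (induction t rule: vertices.induct) simp

lemma leaves_Node_Nil: "leaves (Node []) = {[]}"
  by (auto simp: leaves_def)

lemma Nil_in_leaves_Node: "[] \<in> leaves (Node ts) \<longleftrightarrow> ts = []"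
proof
  assume leaf: "[] \<in> leaves (Node ts)"
  show "ts = []"
  proof (rule ccontr)
    assume "ts \<noteq> []"
    then have "[0] \<in> vertices (Node ts)"
      by (simp only: Cons_in_vertices_Node) (simp add: Nil_in_vertices)
    with leaf show False
      unfolding leaves_def by (metis (mono_tags, lifting) append_Nil mem_Collect_eq)
  qed
qed (simp add: leaves_Node_Nil)

lemma Cons_in_leaves_Node:
  "i # p \<in> leaves (Node ts) \<longleftrightarrow> i < length ts \<and> p \<in> leaves (ts ! i)"
  unfolding leaves_def mem_Collect_eq append_Cons Cons_in_vertices_Node by blast

text \<open>Descending through first children ends at a leaf. A chain must lie on the path to some
  leaf, so this is what makes the root alone a chain.\<close>

lemma leaves_nonempty: "leaves t \<noteq> {}"
proof (induction t)
  case (Node ts)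
  show ?case
  proof (cases ts)
    case Nil
    then show ?thesis by (simp add: leaves_Node_Nil)
  next
    case (Cons t us)
    then obtain p where "p \<in> leaves (ts ! 0)"
      using Node[of "ts ! 0"] by auto
    then have "0 # p \<in> leaves (Node ts)"
      using Cons by (simp add: Cons_in_leaves_Node)
    then show ?thesis by blast
  qed
qed

lemma root_path_Nil: "root_path [] = {[]}"
  by (auto simp: root_path_def)

lemma root_path_Cons: "root_path (i # p) = insert [] ((#) i ` root_path p)"
  by (auto simp: root_path_def prefix_Cons)

lemma finite_root_path: "finite (root_path p)"
  by (induction p) (simp_all add: root_path_Nil root_path_Cons)

lemma finite_chains_of: "finite (chains_of t)"
proof -
  have "finite (\<Union>l\<in>leaves t. Pow (root_path l))"
    by (rule finite_UN_I) (auto simp: leaves_def finite_vertices finite_root_path)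
  moreover have "chains_of t \<subseteq> (\<Union>l\<in>leaves t. Pow (root_path l))"
    by (auto simp: chains_of_def chain_of_def)
  ultimately show ?thesis by (rule rev_finite_subset)
qed

text \<open>All vertices of the path except the root lie below child \<open>i\<close>, so their
  addresses share a first letter that can be stripped. \<open>R\<close> may be empty.\<close>

lemma subset_root_path_Cons_cases:
  assumes "Q \<subseteq> root_path (i # p)"
  obtains R where "R \<subseteq> root_path p" "Q = (#) i ` R \<or> Q = insert [] ((#) i ` R)"
proof -
  have "Q - {[]} \<subseteq> (#) i ` root_path p"
    using assms by (auto simp: root_path_Cons)
  then obtain R where R: "R \<subseteq> root_path p" "Q - {[]} = (#) i ` R"
    by (auto simp: subset_image_iff)
  then have "Q = (#) i ` R \<or> Q = insert [] ((#) i ` R)" by auto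
  with R that show ?thesis by blast
qed

text \<open>The path to a non-root leaf continues in exactly one principal subtree. A chain on it,
  unless it is just the root, restricts to a chain there; the root may be present or absent, whence
  two images per child.\<close>

lemma chains_of_Node:
  "chains_of (Node ts) = insert {[]}
     (\<Union>i<length ts. image ((#) i) ` chains_of (ts ! i) \<union>
                      (\<lambda>R. insert [] ((#) i ` R)) ` chains_of (ts ! i))"
  (is "_ = insert _ (\<Union>i<_. ?A i)")
proof (intro equalityI subsetI)
  fix Q assume "Q \<in> chains_of (Node ts)"
  then obtain l where l: "l \<in> leaves (Node ts)" "Q \<subseteq> root_path l" and ne: "Q \<noteq> {}"
    by (auto simp: chains_of_def chain_of_def)
  show "Q \<in> insert {[]} (\<Union>i<length ts. ?A i)"
  proof (cases l)
    case Nil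
    then show ?thesis using l ne by (auto simp: root_path_Nil)
  next
    case (Cons i p)
    then have i: "i < length ts" "p \<in> leaves (ts ! i)"
      using l by (simp_all add: Cons_in_leaves_Node)
    obtain R where R: "R \<subseteq> root_path p" "Q = (#) i ` R \<or> Q = insert [] ((#) i ` R)"
      using subset_root_path_Cons_cases l Cons by metis
    show ?thesis
    \<comment> \<open>As \<open>Q\<close> is nonempty, an empty \<open>R\<close> leaves only
      \<open>Q = {[]}\<close>.\<close>
    proof (cases "R = {}")
      case True
      then show ?thesis using R ne by auto
    next
      case False
      then have "R \<in> chains_of (ts ! i)"
        using R i by (auto simp: chains_of_def chain_of_def)
      then have "Q \<in> ?A i" using R by blast
      then show ?thesis using i by blast
    qed
  qed
next
  fix Q assume "Q \<in> insert {[]} (\<Union>i<length ts. ?A i)"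
  then consider "Q = {[]}"
    | i R where "i < length ts" "R \<in> chains_of (ts ! i)" "Q = (#) i ` R \<or> Q = insert [] ((#) i ` R)"
    by blast
  then show "Q \<in> chains_of (Node ts)"
  proof cases
    case 1
    then show ?thesis
      using leaves_nonempty[of "Node ts"] by (auto simp: chains_of_def chain_of_def root_path_def)
  next
    case 2
    then obtain p where p: "p \<in> leaves (ts ! i)" "R \<subseteq> root_path p" "R \<noteq> {}"
      by (auto simp: chains_of_def chain_of_def)
    then have "i # p \<in> leaves (Node ts)" "Q \<subseteq> root_path (i # p)" "Q \<noteq> {}"
      using 2 by (auto simp: Cons_in_leaves_Node root_path_Cons)
    then show ?thesis by (auto simp: chains_of_def chain_of_def)
  qed
qed

text \<open>The summand 1 counts the root alone, the factor 2 the choice of including the root. The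
  work lies in showing that the pieces of the union in \<open>chains_of_Node\<close> do not
  overlap.\<close>

lemma card_chains_of_Node:
  "card (chains_of (Node ts)) = 1 + 2 * (\<Sum>t\<leftarrow>ts. card (chains_of t))"
proof -
  let ?L = "\<lambda>i. image ((#) i) ` chains_of (ts ! i)"
  let ?R = "\<lambda>i. (\<lambda>R. insert [] ((#) i ` R)) ` chains_of (ts ! i)"
  let ?A = "\<lambda>i. ?L i \<union> ?R i"
  have ne: "R \<noteq> {}" if "R \<in> chains_of t" for R t
    using that by (simp add: chains_of_def chain_of_def)
  have fin: "finite (?A i)" for i
    by (simp add: finite_chains_of)
  \<comment> \<open>Chains of a subtree are nonempty, so each member of \<open>?A i\<close> contains
    a vertex other than the root.\<close>
  have "{[]} \<notin> ?A i" for i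
    using ne by fastforce
  then have "card (chains_of (Node ts)) = 1 + card (\<Union>i<length ts. ?A i)"
    unfolding chains_of_Node using fin by (subst card_insert_disjoint) auto
  also have "card (\<Union>i<length ts. ?A i) = (\<Sum>i<length ts. card (?A i))"
  proof (rule card_UN_disjoint)
    show "\<forall>i\<in>{..<length ts}. \<forall>j\<in>{..<length ts}. i \<noteq> j \<longrightarrow> ?A i \<inter> ?A j = {}"
    proof (intro ballI impI equals0I)
      fix i j Q assume "i \<noteq> j" "Q \<in> ?A i \<inter> ?A j"
      \<comment> \<open>The first letter of a non-root address names the child it lies below, so
        \<open>Q\<close> determines its index.\<close>
      have heads: "hd ` (Q - {[]}) = {k}" if Q: "Q \<in> ?A k" for k
      proof -
        obtain R where R: "R \<in> chains_of (ts ! k)" "Q = (#) k ` R \<or> Q = insert [] ((#) k ` R)"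
          using Q by blast
        then have "Q - {[]} = (#) k ` R" by auto
        then show ?thesis using ne[OF R(1)] by (auto simp: image_image)
      qed
      from \<open>Q \<in> ?A i \<inter> ?A j\<close> have "{i} = {j}"
        using heads[of i] heads[of j] by blast
      with \<open>i \<noteq> j\<close> show False by simp
    qed
  qed (use fin in auto)
  also have "\<dots> = (\<Sum>i<length ts. 2 * card (chains_of (ts ! i)))"
  proof (rule sum.cong)
    fix i
    have inj_L: "inj_on (image ((#) i)) (chains_of (ts ! i))"
      by (simp add: inj_on_def inj_image_eq_iff)
    have inj_R: "inj_on (\<lambda>R. insert [] ((#) i ` R)) (chains_of (ts ! i))"
    proof (rule inj_onI)
      fix R R' assume "insert [] ((#) i ` R) = insert [] ((#) i ` R')"
      \<comment> \<open>The root lies in neither image, so it cancels on both sides.\<close>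
      then have "(#) i ` R = (#) i ` R'"
        by (subst (asm) insert_ident) auto
      then show "R = R'" by (simp add: inj_image_eq_iff)
    qed
    \<comment> \<open>Members of \<open>?R i\<close> contain the root, members of
      \<open>?L i\<close> do not.\<close>
    have "?L i \<inter> ?R i = {}" by fastforce
    then have "card (?A i) = card (?L i) + card (?R i)"
      by (intro card_Un_disjoint) (simp_all add: finite_chains_of)
    then show "card (?A i) = 2 * card (chains_of (ts ! i))"
      by (simp add: card_image inj_L inj_R)
  qed simp
  also have "\<dots> = 2 * (\<Sum>t\<leftarrow>ts. card (chains_of t))"
    by (simp add: sum_list_sum_nth sum_distrib_left atLeast0LessThan)
  finally show ?thesis .
qed

text \<open>The new child \<open>t\<close> contributes twice; the root alone and the old children
  together make up the chains of \<open>u\<close>.\<close>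

lemma card_chains_of_graft_left:
  "card (chains_of (graft_left t u)) = 2 * card (chains_of t) + card (chains_of u)"
  by (cases u) (simp add: card_chains_of_Node)


subsection \<open>Generating functions\<close>

lemma trees_of_size_0: "trees_of_size 0 = {Node []}"
proof -
  have "num_edges t = 0 \<longleftrightarrow> t = Node []" for t
    by (cases t) auto
  then show ?thesis by (auto simp: trees_of_size_def)
qed

lemma num_edges_graft_left: "num_edges (graft_left t u) = Suc (num_edges t + num_edges u)"
  by (cases u) simp

lemma graft_left_inject: "graft_left t u = graft_left t' u' \<longleftrightarrow> t = t' \<and> u = u'"
  by (cases u; cases u') auto

lemma trees_of_size_Suc:
  "trees_of_size (Suc n) =
     case_prod graft_left ` (\<Union>i\<in>{0..n}. trees_of_size i \<times> trees_of_size (n - i))"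
proof (intro equalityI subsetI)
  fix s assume s: "s \<in> trees_of_size (Suc n)"
  then obtain t ts where ts: "s = Node (t # ts)"
    by (cases s; cases "case s of Node us \<Rightarrow> us") (auto simp: trees_of_size_def)
  then have s_eq: "s = graft_left t (Node ts)" by simp
  with s have "num_edges t + num_edges (Node ts) = n"
    using num_edges_graft_left[of t "Node ts"] by (simp add: trees_of_size_def)
  then have "(t, Node ts) \<in> (\<Union>i\<in>{0..n}. trees_of_size i \<times> trees_of_size (n - i))"
    by (auto simp: trees_of_size_def)
  with s_eq show "s \<in> case_prod graft_left ` (\<Union>i\<in>{0..n}. trees_of_size i \<times> trees_of_size (n - i))"
    by (intro image_eqI[where x = "(t, Node ts)"]) simp_all
qed (auto simp: trees_of_size_def num_edges_graft_left)

text \<open>Both pieces of a decomposed tree have fewer edges, hence strong induction.\<close>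

lemma finite_trees_of_size: "finite (trees_of_size n)"
proof (induction n rule: less_induct)
  case (less n)
  show ?case
  proof (cases n)
    case 0
    then show ?thesis by (simp add: trees_of_size_0)
  next
    case (Suc m)
    then have "finite (trees_of_size i)" if "i \<le> m" for i
      using less that by simp
    then show ?thesis unfolding Suc trees_of_size_Suc by auto
  qed
qed

text \<open>Stated for arbitrary \<open>f\<close> to serve both recurrences: the constant 1 counts
  trees, the number of chains gives \<open>H\<close>.\<close>

lemma sum_trees_of_size_Suc:
  fixes f :: "plane_tree \<Rightarrow> 'a::comm_monoid_add"
  shows "(\<Sum>t\<in>trees_of_size (Suc n). f t) =
    (\<Sum>i=0..n. \<Sum>t\<in>trees_of_size i. \<Sum>u\<in>trees_of_size (n - i). f (graft_left t u))"
proof -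
  let ?P = "\<lambda>i. trees_of_size i \<times> trees_of_size (n - i)"
  have "inj_on (case_prod graft_left) (\<Union>i\<in>{0..n}. ?P i)"
    by (auto simp: inj_on_def graft_left_inject)
  then have "(\<Sum>t\<in>trees_of_size (Suc n). f t) = (\<Sum>p\<in>(\<Union>i\<in>{0..n}. ?P i). f (case_prod graft_left p))"
    unfolding trees_of_size_Suc by (simp add: sum.reindex)
  also have "\<dots> = (\<Sum>i=0..n. \<Sum>p\<in>?P i. f (case_prod graft_left p))"
    \<comment> \<open>The edge count of the first component determines \<open>i\<close>, so the
      products are disjoint.\<close>
    by (rule sum.UNION_disjoint) (auto simp: finite_trees_of_size, auto simp: trees_of_size_def)
  also have "\<dots> = (\<Sum>i=0..n. \<Sum>t\<in>trees_of_size i. \<Sum>u\<in>trees_of_size (n - i). f (graft_left t u))"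
    by (simp add: sum.cartesian_product case_prod_unfold)
  finally show ?thesis .
qed

section \<open>Power series and their functional equations\<close>

lemma H_eq_sum_card_chains_of: "H n = (\<Sum>t\<in>trees_of_size n. card (chains_of t))"
proof -
  have "{(t, Q). num_edges t = n \<and> chain_of t Q} = Sigma (trees_of_size n) chains_of"
    by (auto simp: trees_of_size_def chains_of_def)
  then show ?thesis
    by (simp add: H_def finite_trees_of_size finite_chains_of card_SigmaI)
qed

text \<open>This is the generating function of the Catalan numbers.\<close>

definition tree_gf :: "real fps" where
  "tree_gf = Abs_fps (\<lambda>n. real (card (trees_of_size n)))"

definition chain_gf :: "real fps" where
  "chain_gf = Abs_fps (\<lambda>n. real (H n))"

lemma tree_gf_eq: "tree_gf = 1 + fps_X * tree_gf ^ 2"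
proof (rule fps_ext)
  fix n
  show "tree_gf $ n = (1 + fps_X * tree_gf ^ 2) $ n"
  proof (cases n)
    case 0
    then show ?thesis by (simp add: tree_gf_def trees_of_size_0)
  next
    case (Suc m)
    have "card (trees_of_size (Suc m)) =
        (\<Sum>i=0..m. card (trees_of_size i) * card (trees_of_size (m - i)))"
      using sum_trees_of_size_Suc[of "\<lambda>_. 1::nat" m] by simp
    then have "tree_gf $ Suc m = (tree_gf * tree_gf) $ m"
      by (simp add: tree_gf_def fps_mult_nth)
    then show ?thesis
      by (simp add: Suc power2_eq_square)
  qed
qed

lemma chain_gf_eq: "chain_gf = 1 + 3 * fps_X * tree_gf * chain_gf"
proof -
  \<comment> \<open>The two equal products record a chain of the leftmost subtree, with or without
    the root; the last records a chain of the remaining tree. Commutativity merges them into the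
    factor 3.\<close>
  have "chain_gf = 1 + fps_X * (chain_gf * tree_gf + chain_gf * tree_gf + tree_gf * chain_gf)"
  proof (rule fps_ext)
    fix n
    show "chain_gf $ n =
        (1 + fps_X * (chain_gf * tree_gf + chain_gf * tree_gf + tree_gf * chain_gf)) $ n"
    proof (cases n)
      case 0
      then show ?thesis
        by (simp add: chain_gf_def H_eq_sum_card_chains_of trees_of_size_0 card_chains_of_Node)
    next
      case (Suc m)
      have "H (Suc m) = (\<Sum>i=0..m. 2 * (H i * card (trees_of_size (m - i)))
          + card (trees_of_size i) * H (m - i))"
        unfolding H_eq_sum_card_chains_of sum_trees_of_size_Suc card_chains_of_graft_left
        by (simp add: sum.distrib sum_distrib_left sum_distrib_right mult_ac)
      then have "chain_gf $ Suc m =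
          2 * (chain_gf * tree_gf) $ m + (tree_gf * chain_gf) $ m"
        by (simp add: tree_gf_def chain_gf_def fps_mult_nth sum.distrib sum_distrib_left)
      then show ?thesis
        unfolding Suc by (simp only: fps_add_nth fps_X_mult_nth fps_one_nth) simp
    qed
  qed
  also have "fps_X * (chain_gf * tree_gf + chain_gf * tree_gf + tree_gf * chain_gf) =
      3 * fps_X * tree_gf * chain_gf"
    by (simp add: algebra_simps)
  finally show ?thesis .
qed

text \<open>Completing the square in the quadratic equation for \<open>tree_gf\<close> shows that
  the right-hand side squares to \<open>1 - 4 * fps_X\<close>; its constant term 1 selects the
  branch.\<close>

lemma fps_radical_one_minus_4X: "fps_radical root 2 (1 - 4 * fps_X) = 1 - 2 * fps_X * tree_gf"
proof -
  let ?S = "1 - 2 * fps_X * tree_gf"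
  have "?S ^ 2 = 1 - 4 * fps_X * (tree_gf - fps_X * tree_gf ^ 2)"
    by (simp add: algebra_simps power2_eq_square)
  also have "tree_gf - fps_X * tree_gf ^ 2 = 1"
    unfolding diff_eq_eq by (rule tree_gf_eq)
  finally have "?S ^ 2 = 1 - 4 * fps_X" by simp
  then show ?thesis
    \<comment> \<open>The index \<open>1\<close> stands for the exponent \<open>Suc 1\<close>, a
      square root.\<close>
    using radical_unique[of root 1 "1 - 4 * fps_X" ?S] by (simp add: numeral_2_eq_2)
qed

theorem theorem6p2:
  "let B = 1 / fps_radical root 2 (1 - 4 * fps_X) :: real fps
   in Abs_fps (\<lambda>n. real (H n)) = 2 * B / (3 - B)"
proof -
  define S where "S = fps_radical root 2 (1 - 4 * fps_X :: real fps)"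
  define B where "B = 1 / S"
  have S_eq: "S = 1 - 2 * fps_X * tree_gf"
    by (simp add: S_def fps_radical_one_minus_4X)
  then have S0: "S $ 0 = 1" by simp
  then have SB: "S * B = 1" and B0: "B $ 0 = 1"
    unfolding B_def by (simp_all add: fps_divide_unit inverse_mult_eq_1')
  \<comment> \<open>Here \<open>3 * S - 1\<close> is twice \<open>1 - 3 * fps_X * tree_gf\<close>,
    which \<open>chain_gf_eq\<close> makes the inverse of \<open>chain_gf\<close>.\<close>
  have "chain_gf * (3 * S - 1) = 2 * (chain_gf - 3 * fps_X * tree_gf * chain_gf)"
    unfolding S_eq by (simp add: algebra_simps)
  also have "chain_gf - 3 * fps_X * tree_gf * chain_gf = 1"
    unfolding diff_eq_eq by (rule chain_gf_eq)
  finally have "chain_gf * (3 * S - 1) * B = 2 * B" by simp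
  moreover have "(3 * S - 1) * B = 3 - B"
    using SB by (simp add: algebra_simps)
  ultimately have "chain_gf * (3 - B) = 2 * B"
    by (simp add: mult.assoc)
  \<comment> \<open>The constant term is 2, which permits cancelling \<open>3 - B\<close>.\<close>
  moreover have "3 - B \<noteq> 0"
  proof
    assume "3 - B = 0"
    then have "(3 - B) $ 0 = 0" by simp
    then show False using B0 by simp
  qed
  ultimately have "chain_gf = 2 * B / (3 - B)"
    by (metis nonzero_mult_div_cancel_right)
  then show ?thesis by (simp add: Let_def B_def S_def chain_gf_def)
qed

end
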